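(* Let $\kappa,N$ be relatively prime integers with $0<\kappa<N$, let $k,k'$ be the integers with $0<k<N$, $0<k'<N$, $\kappa k\equiv -1\pmod N$, $\kappa k'\equiv2\pmod N$, and let $n>1$ and $l\ge1$ be integers with $2l\le n$. Let $r=(r_1,\dots,r_l)\in\mathbb Z_{>0}^l$ be such that $r_i\equiv-1\pmod N$ for all $i$. Let $f_r(z)$ be the $N$-hypergeometric solution of the qKZ equations and let $f_r^0(z)$ be the $N$-hypergeometric solution of the KZ equations, both defined in the context, where $z=(z_1,\dots,z_n)$. Then $$f_r(z)=f_r^0(z)+\dots,$$ where the dots denote the terms of degree less than $\deg f_r^0(z)$.
   Context: **Vectors and degrees.** $V$ is the two-dimensional $\mathfrak{sl}_2$-module with basis $v_1,v_2$. $\mathcal I_l$ is the set of $l$-element subsets of $\{1,\dots,n\}$; for $I\in\mathcal I_l$, $v_I=v_{i_1}\otimes\dots\otimes v_{i_n}\in V^{\otimes n}$ with $i_j=2$ if $j\in I$ and $i_j=1$ if $j\notin I$. Write $t=(t_1,\dots,t_l)$. The degree of polynomials is defined by $\deg t_i=\deg z_j=1$ for all $i,j$. **Pochhammer polynomials.** $[x]_m=\prod_{i=1}^m(x-(i-1)\kappa)$, $[x]_0=1$. **Definition of $f_r$ (qKZ).** Let $$\Phi(t,z)=\prod_{a=1}^n\prod_{i=1}^l[t_i-z_a]_k\prod_{1\le i<j\le l}[t_i-t_j+1]_{k'}.$$ For $\tau\in S_l$ and a function $g(t)$ put $$(\tau g)(t_1,\dots,t_l)=g(t_{\tau(1)},\dots,t_{\tau(l)})\prod_{i<j,\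 \tau(i)>\tau(j)}\frac{t_i-t_j+1-\kappa k'}{t_i-t_j+1}.$$ For $I=\{a_1<\dots<a_l\}\in\mathcal I_l$ put $$w_I(t,z)=\sum_{\tau\in S_l}\tau\left(\prod_{i=1}^l\frac1{t_i-z_{a_i}}\prod_{j=1}^{a_i-1}\frac{t_i-z_j-\kappa k}{t_i-z_j}\right),\qquad U_I(t,z)=\Phi(t,z)\,w_I(t,z).$$ Each $U_I$ is a polynomial in $t,z$ with integer coefficients. The products $\prod_{i=1}^l[t_i]_{m_i}$, $m\in\mathbb Z_{\ge0}^l$, form a $\mathbb Z[z]$-basis of $\mathbb Z[z][t]$; write $U_I(t,z)=\sum_m c_{I,m}(z)\prod_{i=1}^l[t_i]_{m_i}$ with $c_{I,m}(z)\in\mathbb Z[z]$. The solution $f_r$ is the difference $r$-integral $f_r(z)=N_r\sum_{I\in\mathcal I_l}c_{I,r}(z)\,v_I$, where $N_r$ is the least positive integer with $N_r(r_i+1)\equiv0\pmod N$ for all $i$; since here $r_i\equiv-1\pmod N$ for all $i$, $N_r=1$, so $f_r(z)=\sum_{I\in\mathcal I_l}c_{I,r}(z)\,v_I$. **Definition of $f_r^0$ (KZ).** Let $\Phi^0(t,z)=\prod_{a=1}^n\prod_{i=1}^l(t_i-z_a)^k\prod_{1\le i<j\le l}(t_i-t_j)^{k'}$, and for $I=\{a_1<\dots<a_l\}\in\mathcal I_l$ let $$w_I^0(t,z)=\sum_{\tau\in S_l}\prod_{i=1}^l\frac1{t_{\tau(i)}-z_{a_i}},\qquad U_I^0(t,z)=\Phi^0(t,z)\,w_I^0(t,z)=\sum_{m}c^0_{I,m}(z)\,t_1^{m_1}\cdots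 t_l^{m_l},\quad c^0_{I,m}(z)\in\mathbb Z[z].$$ Then $f_r^0(z)=\sum_{I\in\mathcal I_l}c^0_{I,r}(z)\,v_I$. It is a homogeneous polynomial in $z$ of degree $nlk+\frac{l(l-1)}2k'-l-\sum_{i=1}^l r_i$. *)

theory Defs
  imports
    "HOL-Library.Poly_Mapping"
    "HOL-Combinatorics.Permutations"
    "HOL-Computational_Algebra.Polynomial_Factorial"
    "HOL-Number_Theory.Cong"
begin

text \<open>
  A monomial in variables indexed by the natural numbers is its exponent vector. The ring of
  multivariate polynomials over \<open>R\<close> is the monoid algebra \<open>(nat \<Rightarrow>\<^sub>0 nat) \<Rightarrow>\<^sub>0 R\<close>, with the
  multiplication of \<^theory>\<open>HOL-Library.Poly_Mapping\<close>. The type \<open>zpoly\<close> is \<open>\<int>[z]\<close>, the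
  type \<open>tzpoly\<close> is \<open>\<int>[z][t]\<close>, and \<open>tzpoly fract\<close> is the field of rational functions in \<open>t, z\<close>.
  The variables are \<open>t\<^sub>1, \<dots>, t\<^sub>l\<close> and \<open>z\<^sub>1, \<dots>, z\<^sub>n\<close>; other indices are never used.
\<close>

type_synonym mon = "nat \<Rightarrow>\<^sub>0 nat"
type_synonym zpoly = "mon \<Rightarrow>\<^sub>0 int"
type_synonym tzpoly = "mon \<Rightarrow>\<^sub>0 zpoly"

definition mon_deg :: "mon \<Rightarrow> nat" where
  "mon_deg m = (\<Sum>i\<in>Poly_Mapping.keys m. Poly_Mapping.lookup m i)"

definition var :: "nat \<Rightarrow> mon \<Rightarrow>\<^sub>0 'a::comm_ring_1" where
  "var i = Poly_Mapping.single (Poly_Mapping.single i 1) 1"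

definition const :: "'a \<Rightarrow> mon \<Rightarrow>\<^sub>0 'a::comm_ring_1" where
  "const c = Poly_Mapping.single 0 c"

definition tvar :: "nat \<Rightarrow> tzpoly" where
  "tvar i = var i"

definition zvar :: "nat \<Rightarrow> tzpoly" where
  "zvar a = const (var a)"

text \<open>The basis vector \<open>v\<^bsub>i\<^sub>1\<^esub> \<otimes> \<dots> \<otimes> v\<^bsub>i\<^sub>n\<^esub>\<close> of \<open>V\<^bsup>\<otimes>n\<^esup>\<close> is represented by the list \<open>[i\<^sub>1, \<dots>, i\<^sub>n]\<close>
  with entries in \<open>{1, 2}\<close>; a vector with coefficients in \<open>\<int>[z]\<close> is a finitely supported function
  on such lists.\<close>

type_synonym tensor = "nat list \<Rightarrow>\<^sub>0 zpoly"

definition smult_tensor :: "zpoly \<Rightarrow> tensor \<Rightarrow> tensor" where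
  "smult_tensor c = Poly_Mapping.map (\<lambda>x. c * x)"

definition v_basis :: "nat \<Rightarrow> nat set \<Rightarrow> tensor" where
  "v_basis n I = Poly_Mapping.single (map (\<lambda>j. if j \<in> I then 2 else 1) [1..<n+1]) 1"

definition subsets :: "nat \<Rightarrow> nat \<Rightarrow> nat set set" where
  "subsets n l = {I. I \<subseteq> {1..n} \<and> card I = l}"

text \<open>\<open>elt I i\<close> is \<open>a\<^sub>i\<close> for \<open>I = {a\<^sub>1 < \<dots> < a\<^sub>l}\<close> and \<open>1 \<le> i \<le> l\<close>.\<close>

definition elt :: "nat set \<Rightarrow> nat \<Rightarrow> nat" where
  "elt I i = sorted_list_of_set I ! (i - 1)"

definition pairs :: "nat \<Rightarrow> (nat \<times> nat) set" where
  "pairs l = {(i, j). 1 \<le> i \<and> i < j \<and> j \<le> l}"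

definition poch :: "int \<Rightarrow> 'a::comm_ring_1 \<Rightarrow> nat \<Rightarrow> 'a" where
  "poch \<kappa> x m = (\<Prod>i=1..m. x - of_int ((int i - 1) * \<kappa>))"


text \<open>The functions of \<open>t\<close> and \<open>z\<close> are defined over an arbitrary field; the rational functions of the
  construction are their values at the generic point, i.e. at the variables. This makes the
  substitution of variables in the action of permutations plain composition.\<close>

definition Phi_qKZ :: "int \<Rightarrow> nat \<Rightarrow> nat \<Rightarrow> nat \<Rightarrow> nat \<Rightarrow> (nat \<Rightarrow> 'a::field) \<Rightarrow> (nat \<Rightarrow> 'a) \<Rightarrow> 'a" where
  "Phi_qKZ \<kappa> k k' n l t z =
     (\<Prod>a=1..n. \<Prod>i=1..l. poch \<kappa> (t i - z a) k) *
     (\<Prod>(i, j)\<in>pairs l. poch \<kappa> (t i - t j + 1) k')"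

definition act :: "int \<Rightarrow> nat \<Rightarrow> nat \<Rightarrow> (nat \<Rightarrow> nat) \<Rightarrow>
    ((nat \<Rightarrow> 'a::field) \<Rightarrow> 'a) \<Rightarrow> (nat \<Rightarrow> 'a) \<Rightarrow> 'a" where
  "act \<kappa> k' l \<tau> g t =
     g (\<lambda>i. t (\<tau> i)) *
     (\<Prod>(i, j)\<in>{(i, j)\<in>pairs l. \<tau> i > \<tau> j}.
        (t i - t j + 1 - of_int (\<kappa> * int k')) / (t i - t j + 1))"

definition w_qKZ :: "int \<Rightarrow> nat \<Rightarrow> nat \<Rightarrow> nat \<Rightarrow> nat set \<Rightarrow> (nat \<Rightarrow> 'a::field) \<Rightarrow> (nat \<Rightarrow> 'a) \<Rightarrow> 'a" where
  "w_qKZ \<kappa> k k' l I t z =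
     (\<Sum>\<tau> | \<tau> permutes {1..l}.
        act \<kappa> k' l \<tau>
          (\<lambda>s. \<Prod>i=1..l. 1 / (s i - z (elt I i)) *
                 (\<Prod>j=1..elt I i - 1. (s i - z j - of_int (\<kappa> * int k)) / (s i - z j))) t)"

definition U_qKZ :: "int \<Rightarrow> nat \<Rightarrow> nat \<Rightarrow> nat \<Rightarrow> nat \<Rightarrow> nat set \<Rightarrow> tzpoly" where
  "U_qKZ \<kappa> k k' n l I =
     (THE u. to_fract u =
        Phi_qKZ \<kappa> k k' n l (\<lambda>i. to_fract (tvar i)) (\<lambda>a. to_fract (zvar a)) *
        w_qKZ \<kappa> k k' l I (\<lambda>i. to_fract (tvar i)) (\<lambda>a. to_fract (zvar a)))"

text \<open>The coefficients \<open>c\<^bsub>I,m\<^esub>\<close>, \<open>m \<in> \<int>\<^bsub>\<ge>0\<^esub>\<^sup>l\<close>, with respect to the basis \<open>\<Prod>\<^sub>i [t\<^sub>i]\<^bsub>m\<^sub>i\<^esub>\<close>; tuples of length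
  \<open>l\<close> are exponent vectors supported in \<open>{1, \<dots>, l}\<close>.\<close>

definition coeff_qKZ :: "int \<Rightarrow> nat \<Rightarrow> nat \<Rightarrow> nat \<Rightarrow> nat \<Rightarrow> nat set \<Rightarrow> mon \<Rightarrow>\<^sub>0 zpoly" where
  "coeff_qKZ \<kappa> k k' n l I =
     (THE c. (\<forall>m\<in>Poly_Mapping.keys c. Poly_Mapping.keys m \<subseteq> {1..l}) \<and>
        U_qKZ \<kappa> k k' n l I =
          (\<Sum>m\<in>Poly_Mapping.keys c. const (Poly_Mapping.lookup c m) *
             (\<Prod>i=1..l. poch \<kappa> (tvar i) (Poly_Mapping.lookup m i))))"

definition norm_factor :: "int \<Rightarrow> nat \<Rightarrow> mon \<Rightarrow> nat" where
  "norm_factor N l r =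
     (LEAST q. 0 < q \<and> (\<forall>i\<in>{1..l}. [int q * (int (Poly_Mapping.lookup r i) + 1) = 0] (mod N)))"

definition f_qKZ :: "int \<Rightarrow> int \<Rightarrow> nat \<Rightarrow> nat \<Rightarrow> nat \<Rightarrow> nat \<Rightarrow> mon \<Rightarrow> tensor" where
  "f_qKZ N \<kappa> k k' n l r =
     smult_tensor (of_nat (norm_factor N l r))
       (\<Sum>I\<in>subsets n l. smult_tensor (Poly_Mapping.lookup (coeff_qKZ \<kappa> k k' n l I) r) (v_basis n I))"


definition Phi_KZ :: "nat \<Rightarrow> nat \<Rightarrow> nat \<Rightarrow> nat \<Rightarrow> (nat \<Rightarrow> 'a::field) \<Rightarrow> (nat \<Rightarrow> 'a) \<Rightarrow> 'a" where
  "Phi_KZ k k' n l t z =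
     (\<Prod>a=1..n. \<Prod>i=1..l. (t i - z a) ^ k) * (\<Prod>(i, j)\<in>pairs l. (t i - t j) ^ k')"

definition w_KZ :: "nat \<Rightarrow> nat set \<Rightarrow> (nat \<Rightarrow> 'a::field) \<Rightarrow> (nat \<Rightarrow> 'a) \<Rightarrow> 'a" where
  "w_KZ l I t z = (\<Sum>\<tau> | \<tau> permutes {1..l}. \<Prod>i=1..l. 1 / (t (\<tau> i) - z (elt I i)))"

definition U_KZ :: "nat \<Rightarrow> nat \<Rightarrow> nat \<Rightarrow> nat \<Rightarrow> nat set \<Rightarrow> tzpoly" where
  "U_KZ k k' n l I =
     (THE u. to_fract u =
        Phi_KZ k k' n l (\<lambda>i. to_fract (tvar i)) (\<lambda>a. to_fract (zvar a)) *
        w_KZ l I (\<lambda>i. to_fract (tvar i)) (\<lambda>a. to_fract (zvar a)))"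

definition f_KZ :: "nat \<Rightarrow> nat \<Rightarrow> nat \<Rightarrow> nat \<Rightarrow> mon \<Rightarrow> tensor" where
  "f_KZ k k' n l r =
     (\<Sum>I\<in>subsets n l. smult_tensor (Poly_Mapping.lookup (U_KZ k k' n l I) r) (v_basis n I))"


text \<open>The degree of \<open>f\<^sub>r\<^sup>0\<close> as a homogeneous polynomial. It is an integer and not a natural number:
  when \<open>r\<close> is large the number is negative, and then \<open>f\<^sub>r\<^sup>0 = 0\<close>.\<close>

definition deg_KZ :: "nat \<Rightarrow> nat \<Rightarrow> nat \<Rightarrow> nat \<Rightarrow> mon \<Rightarrow> int" where
  "deg_KZ k k' n l r =
     int n * int l * int k + (int l * (int l - 1) div 2) * int k' - int l
       - (\<Sum>i=1..l. int (Poly_Mapping.lookup r i))"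

definition homogeneous_of_degree :: "int \<Rightarrow> tensor \<Rightarrow> bool" where
  "homogeneous_of_degree d f \<longleftrightarrow>
     (\<forall>x. \<forall>m\<in>Poly_Mapping.keys (Poly_Mapping.lookup f x). int (mon_deg m) = d)"

definition terms_of_degree_less :: "int \<Rightarrow> tensor \<Rightarrow> bool" where
  "terms_of_degree_less d f \<longleftrightarrow>
     (\<forall>x. \<forall>m\<in>Poly_Mapping.keys (Poly_Mapping.lookup f x). int (mon_deg m) < d)"

end

theory Submission
  imports Defs
begin

text \<open>Give \<open>\<int>[z][t]\<close> the total degree in \<open>t\<close> and \<open>z\<close>. The leading form of \<open>[x]\<^sub>m\<close> is \<open>x\<^sup>m\<close>, and the
  factors of the permutation action on rational functions of \<open>t\<close> have leading form \<open>1\<close>, so the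
  leading form of \<open>U\<^sub>I\<close> is \<open>U\<^sub>I\<^sup>0\<close>. Since \<open>\<Prod> [t\<^sub>i]\<^bsub>m\<^sub>i\<^esub>\<close> has leading form \<open>t\<^sup>m\<close>, the passage from the
  Pochhammer basis to the monomial basis is unitriangular for the total degree; hence
  \<open>\<Sum> c\<^bsub>I,m\<^esub> t\<^sup>m\<close> also has leading form \<open>U\<^sub>I\<^sup>0\<close>, and comparing coefficients of \<open>t\<^sup>r\<close> gives the claim.\<close>

section \<open>Total degrees and leading forms\<close>

abbreviation lookup where "lookup \<equiv> Poly_Mapping.lookup"
abbreviation keys where "keys \<equiv> Poly_Mapping.keys"
abbreviation single where "single \<equiv> Poly_Mapping.single"

lemma sum_single_lookup:
  assumes "finite S" and "keys p \<subseteq> S"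
  shows "(\<Sum>m\<in>S. single m (lookup p m)) = p"
proof (rule poly_mapping_eqI)
  fix m
  have "lookup (\<Sum>m\<in>S. single m (lookup p m)) m = (\<Sum>m'\<in>S. if m' = m then lookup p m' else 0)"
    by (simp add: lookup_sum lookup_single when_def)
  also have "\<dots> = lookup p m"
    using assms by (auto simp: sum.delta in_keys_iff)
  finally show "lookup (\<Sum>m\<in>S. single m (lookup p m)) m = lookup p m" .
qed

lemma mon_deg_superset:
  assumes "finite S" and "keys m \<subseteq> S"
  shows "mon_deg m = (\<Sum>i\<in>S. lookup m i)"
  unfolding mon_deg_def using assms by (intro sum.mono_neutral_left) (auto simp: in_keys_iff)

lemma mon_deg_zero [simp]: "mon_deg 0 = 0"
  by (simp add: mon_deg_def)

lemma mon_deg_single [simp]: "mon_deg (single i a) = a"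
  by (simp add: mon_deg_superset[of "{i}"])

lemma mon_deg_add: "mon_deg (m + m') = mon_deg m + mon_deg m'"
proof -
  have "keys (m + m') \<subseteq> keys m \<union> keys m'"
    by (rule keys_add)
  then show ?thesis
    by (simp add: mon_deg_superset[of "keys m \<union> keys m'"] lookup_add sum.distrib)
qed

text \<open>Sets of occurring degrees replace a degree function: zero gets the empty set without any
  convention, and homogeneity and degree bounds both become inclusions.\<close>

definition degs :: "zpoly \<Rightarrow> nat set" where
  "degs c = mon_deg ` keys c"

definition tot_degs :: "tzpoly \<Rightarrow> nat set" where
  "tot_degs p = {mon_deg m + d | m d. d \<in> degs (lookup p m)}"

lemma degs_zero [simp]: "degs 0 = {}"
  by (simp add: degs_def)

lemma degs_uminus [simp]: "degs (- c) = degs c"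
  by (simp add: degs_def)

lemma degs_add: "degs (c + c') \<subseteq> degs c \<union> degs c'"
  using keys_add[of c c'] by (auto simp: degs_def)

lemma degs_mult: "degs (c * c') \<subseteq> {d + d' | d d'. d \<in> degs c \<and> d' \<in> degs c'}"
  using keys_mult[of c c'] by (fastforce simp: degs_def mon_deg_add)

lemma tot_degs_zero [simp]: "tot_degs 0 = {}"
  by (simp add: tot_degs_def)

lemma tot_degs_uminus [simp]: "tot_degs (- p) = tot_degs p"
  by (simp add: tot_degs_def)

lemma tot_degs_add: "tot_degs (p + q) \<subseteq> tot_degs p \<union> tot_degs q"
  using degs_add by (fastforce simp: tot_degs_def lookup_add)

lemma tot_degs_diff: "tot_degs (p - q) \<subseteq> tot_degs p \<union> tot_degs q"
  using tot_degs_add[of p "- q"] by simp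

lemma tot_degs_sum: "tot_degs (\<Sum>i\<in>S. p i) \<subseteq> (\<Union>i\<in>S. tot_degs (p i))"
  by (induction S rule: infinite_finite_induct) (use tot_degs_add in fastforce)+

lemma tot_degs_single [simp]: "tot_degs (single m c) = (\<lambda>d. mon_deg m + d) ` degs c"
  by (auto simp: tot_degs_def lookup_single when_def split: if_splits)

lemma degs_lookup: "d \<in> degs (lookup p m) \<Longrightarrow> mon_deg m + d \<in> tot_degs p"
  by (auto simp: tot_degs_def)

lemma tot_degs_mult:
  "tot_degs (p * q) \<subseteq> {d + d' | d d'. d \<in> tot_degs p \<and> d' \<in> tot_degs q}"
proof -
  \<comment> \<open>Bilinear expansion into \<open>t\<close>-monomials reduces the claim to
    \<open>degs_mult\<close> for the coefficients in \<open>z\<close>.\<close>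
  have "p * q = (\<Sum>m\<in>keys p. single m (lookup p m)) * (\<Sum>m'\<in>keys q. single m' (lookup q m'))"
    by (simp add: sum_single_lookup)
  also have "\<dots> = (\<Sum>m\<in>keys p. \<Sum>m'\<in>keys q. single (m + m') (lookup p m * lookup q m'))"
    by (simp add: sum_product mult_single)
  also have "tot_degs \<dots> \<subseteq> (\<Union>m\<in>keys p. \<Union>m'\<in>keys q. tot_degs (single (m + m') (lookup p m * lookup q m')))"
    by (intro order_trans[OF tot_degs_sum] UN_mono order_refl tot_degs_sum)
  also have "\<dots> \<subseteq> {d + d' | d d'. d \<in> tot_degs p \<and> d' \<in> tot_degs q}"
  proof clarsimp
    fix m m' e assume "e \<in> degs (lookup p m * lookup q m')"
    then obtain d d' where "e = d + d'" "d \<in> degs (lookup p m)" "d' \<in> degs (lookup q m')"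
      using degs_mult by blast
    then show "\<exists>d d'. mon_deg (m + m') + e = d + d' \<and> d \<in> tot_degs p \<and> d' \<in> tot_degs q"
      by (intro exI[of _ "mon_deg m + d"] exI[of _ "mon_deg m' + d'"])
        (simp add: mon_deg_add degs_lookup)
  qed
  finally show ?thesis .
qed

lemma tot_degs_one [simp]: "tot_degs 1 = {0}"
  using tot_degs_single[of 0 1] unfolding single_one by (simp add: degs_def)

lemma tot_degs_of_int: "tot_degs (of_int c) \<subseteq> {0}"
  unfolding single_of_int[symmetric] by (auto simp: degs_def)

lemma tot_degs_tvar: "tot_degs (tvar i) = {1}"
  by (simp add: tvar_def var_def degs_def)

lemma tot_degs_zvar: "tot_degs (zvar a) = {1}"
  by (simp add: zvar_def const_def var_def degs_def)

lemma tot_degs_empty_iff: "tot_degs p = {} \<longleftrightarrow> p = 0"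
proof
  assume *: "tot_degs p = {}"
  show "p = 0"
  proof (rule poly_mapping_eqI, rule poly_mapping_eqI)
    fix m m'
    show "lookup (lookup p m) m' = lookup (lookup 0 m) m'"
      using * by (auto simp: tot_degs_def degs_def in_keys_iff)
  qed
qed simp

lemma finite_tot_degs: "finite (tot_degs p)"
proof -
  have "tot_degs p \<subseteq> (\<Union>m\<in>keys p. (\<lambda>d. mon_deg m + d) ` degs (lookup p m))"
    by (fastforce simp: tot_degs_def in_keys_iff)
  then show ?thesis
    by (rule finite_subset) (simp add: degs_def)
qed

text \<open>So \<open>q\<close> is the part of \<open>p\<close> of total degree \<open>d\<close>. It
  may be 0, in which case \<open>p\<close> has only terms of degree below \<open>d\<close>; this
  keeps the relation stable under sums whose top terms cancel.\<close>

definition leading_form :: "nat \<Rightarrow> tzpoly \<Rightarrow> tzpoly \<Rightarrow> bool" where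
  "leading_form d p q \<longleftrightarrow> tot_degs q \<subseteq> {d} \<and> tot_degs (p - q) \<subseteq> {..<d}"

lemma leading_form_mult:
  assumes "leading_form d p q" and "leading_form d' p' q'"
  shows "leading_form (d + d') (p * p') (q * q')"
proof -
  \<comment> \<open>Each of the three products contains a difference of degree below
    \<open>d\<close> or \<open>d'\<close>, and its other factor has degree at most the other
    bound.\<close>
  have *: "p * p' - q * q' = (p - q) * (p' - q') + (p - q) * q' + q * (p' - q')"
    by (simp add: algebra_simps)
  show ?thesis
    using assms tot_degs_mult[of q q'] tot_degs_mult[of "p - q" "p' - q'"]
      tot_degs_mult[of "p - q" q'] tot_degs_mult[of q "p' - q'"]
      tot_degs_add[of "(p - q) * (p' - q') + (p - q) * q'" "q * (p' - q')"]
      tot_degs_add[of "(p - q) * (p' - q')" "(p - q) * q'"]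
    unfolding leading_form_def * by fastforce
qed

lemma leading_form_one: "leading_form 0 1 1"
  by (simp add: leading_form_def)

lemma leading_form_prod:
  "(\<And>i. i \<in> S \<Longrightarrow> leading_form (d i) (p i) (q i)) \<Longrightarrow>
     leading_form (\<Sum>i\<in>S. d i) (\<Prod>i\<in>S. p i) (\<Prod>i\<in>S. q i)"
  by (induction S rule: infinite_finite_induct) (auto intro: leading_form_mult leading_form_one)

lemma leading_form_sum:
  assumes "\<And>i. i \<in> S \<Longrightarrow> leading_form d (p i) (q i)"
  shows "leading_form d (\<Sum>i\<in>S. p i) (\<Sum>i\<in>S. q i)"
proof -
  have "tot_degs (\<Sum>i\<in>S. q i) \<subseteq> {d}"
    using assms tot_degs_sum[of q S] by (fastforce simp: leading_form_def)
  moreover have "tot_degs (\<Sum>i\<in>S. p i - q i) \<subseteq> {..<d}"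
    using assms tot_degs_sum[of "\<lambda>i. p i - q i" S] by (fastforce simp: leading_form_def)
  ultimately show ?thesis
    by (simp add: leading_form_def sum_subtractf)
qed

text \<open>Integers have total degree 0, so every shift by a multiple of \<kappa> is invisible in
  the leading form of a linear factor.\<close>

lemma leading_form_1_diff_of_int:
  assumes "leading_form 1 p q"
  shows "leading_form 1 (p - of_int c) q"
  using assms tot_degs_diff[of "p - q" "of_int c"] tot_degs_of_int[of c]
  unfolding leading_form_def by (fastforce simp: algebra_simps)

lemma leading_form_poch:
  assumes "leading_form 1 p q"
  shows "leading_form m (poch \<kappa> p m) (q ^ m)"
proof -
  have "leading_form (\<Sum>i=1..m. 1) (\<Prod>i=1..m. p - of_int ((int i - 1) * \<kappa>)) (\<Prod>i=1..m. q)"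
    by (intro leading_form_prod leading_form_1_diff_of_int assms)
  then show ?thesis
    by (simp add: poch_def)
qed

section \<open>Expansion in Pochhammer polynomials\<close>

text \<open>The type allows infinitely many variables \<open>t\<close>, while the Pochhammer
  products only see the exponents at \<open>1, ..., l\<close>. Uniqueness of the expansion holds
  under this restriction.\<close>

definition in_vars :: "nat \<Rightarrow> tzpoly \<Rightarrow> bool" where
  "in_vars l p \<longleftrightarrow> (\<forall>m\<in>keys p. keys m \<subseteq> {1..l})"

lemma in_vars_add: "in_vars l p \<Longrightarrow> in_vars l q \<Longrightarrow> in_vars l (p + q)"
  using keys_add[of p q] by (auto simp: in_vars_def)

lemma in_vars_uminus: "in_vars l p \<Longrightarrow> in_vars l (- p)"
  by (simp add: in_vars_def)

lemma in_vars_diff: "in_vars l p \<Longrightarrow> in_vars l q \<Longrightarrow> in_vars l (p - q)"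
  using in_vars_add[of l p "- q"] in_vars_uminus by simp

lemma in_vars_mult:
  assumes "in_vars l p" and "in_vars l q"
  shows "in_vars l (p * q)"
  unfolding in_vars_def
proof
  fix m assume "m \<in> keys (p * q)"
  then obtain a b where "m = a + b" "a \<in> keys p" "b \<in> keys q"
    using keys_mult[of p q] by blast
  then show "keys m \<subseteq> {1..l}"
    using assms keys_add[of a b] unfolding in_vars_def by blast
qed

lemma in_vars_const: "in_vars l (const c)"
  by (simp add: in_vars_def const_def)

lemma in_vars_one: "in_vars l 1"
  by (simp add: in_vars_def)

lemma in_vars_of_int: "in_vars l (of_int c)"
  unfolding single_of_int[symmetric] by (simp add: in_vars_def)

lemma in_vars_tvar: "i \<in> {1..l} \<Longrightarrow> in_vars l (tvar i)"
  by (simp add: in_vars_def tvar_def var_def)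

lemma in_vars_zvar: "in_vars l (zvar a)"
  unfolding zvar_def by (rule in_vars_const)

lemma in_vars_sum: "(\<And>i. i \<in> S \<Longrightarrow> in_vars l (p i)) \<Longrightarrow> in_vars l (\<Sum>i\<in>S. p i)"
  by (induction S rule: infinite_finite_induct) (auto intro: in_vars_add simp: in_vars_def[of l 0])

lemma in_vars_prod: "(\<And>i. i \<in> S \<Longrightarrow> in_vars l (p i)) \<Longrightarrow> in_vars l (\<Prod>i\<in>S. p i)"
  by (induction S rule: infinite_finite_induct) (auto intro: in_vars_mult in_vars_one)

lemma in_vars_poch: "in_vars l p \<Longrightarrow> in_vars l (poch \<kappa> p m)"
  unfolding poch_def by (intro in_vars_prod in_vars_diff in_vars_of_int)

lemmas in_vars_intros = in_vars_add in_vars_diff in_vars_mult in_vars_const in_vars_one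
  in_vars_of_int in_vars_tvar in_vars_zvar in_vars_sum in_vars_prod in_vars_poch

definition poch_basis :: "int \<Rightarrow> nat \<Rightarrow> mon \<Rightarrow> tzpoly" where
  "poch_basis \<kappa> l m = (\<Prod>i=1..l. poch \<kappa> (tvar i) (lookup m i))"

text \<open>A coefficient family is itself an element of \<open>tzpoly\<close>, its expansion in
  ordinary monomials. The change of basis is thus an additive endomorphism that can be compared with
  the identity.\<close>

definition poch_expand :: "int \<Rightarrow> nat \<Rightarrow> tzpoly \<Rightarrow> tzpoly" where
  "poch_expand \<kappa> l c = (\<Sum>m\<in>keys c. const (lookup c m) * poch_basis \<kappa> l m)"

lemma poch_expand_superset:
  assumes "finite S" and "keys c \<subseteq> S"
  shows "poch_expand \<kappa> l c = (\<Sum>m\<in>S. const (lookup c m) * poch_basis \<kappa> l m)"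
  unfolding poch_expand_def using assms
  by (intro sum.mono_neutral_left) (auto simp: in_keys_iff const_def)

lemma poch_expand_add: "poch_expand \<kappa> l (c + c') = poch_expand \<kappa> l c + poch_expand \<kappa> l c'"
  using keys_add[of c c']
  by (simp add: poch_expand_superset[of "keys c \<union> keys c'"] lookup_add const_def single_add
      distrib_right sum.distrib)

lemma poch_expand_diff: "poch_expand \<kappa> l (c - c') = poch_expand \<kappa> l c - poch_expand \<kappa> l c'"
  using poch_expand_add[of \<kappa> l "c - c'" c'] by simp

lemma single_power: "single (single (i::nat) 1) (1::'a::comm_ring_1) ^ m = single (single i m) 1"
  by (induction m) (simp_all add: mult_single flip: single_add)

lemma prod_single_one: "(\<Prod>i\<in>S. single (m i :: mon) (1::'a::comm_ring_1)) = single (\<Sum>i\<in>S. m i) 1"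
  by (induction S rule: infinite_finite_induct) (simp_all add: mult_single)

lemma monomial_eq_prod_tvar:
  assumes "keys m \<subseteq> {1..l}"
  shows "(\<Prod>i=1..l. tvar i ^ lookup m i) = single m 1"
  using assms by (simp add: tvar_def var_def single_power prod_single_one sum_single_lookup
    del: One_nat_def)

lemma leading_form_poch_basis:
  assumes "keys m \<subseteq> {1..l}"
  shows "leading_form (mon_deg m) (poch_basis \<kappa> l m) (single m 1)"
proof -
  have "leading_form (\<Sum>i=1..l. lookup m i) (poch_basis \<kappa> l m) (\<Prod>i=1..l. tvar i ^ lookup m i)"
    unfolding poch_basis_def
    by (intro leading_form_prod leading_form_poch) (simp add: leading_form_def tot_degs_tvar)
  then show ?thesis
    unfolding monomial_eq_prod_tvar[OF assms] using assms by (simp add: mon_deg_superset[of "{1..l}"])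
qed

text \<open>Each monomial of \<open>c\<close> in \<open>t\<close> is replaced by a Pochhammer
  product with that monomial as leading form, so the error has strictly smaller total
  degree.\<close>

lemma poch_expand_unitriangular:
  assumes "in_vars l c" and "tot_degs c \<subseteq> {..d}"
  shows "tot_degs (poch_expand \<kappa> l c - c) \<subseteq> {..<d}"
proof -
  have "poch_expand \<kappa> l c - c = (\<Sum>m\<in>keys c. const (lookup c m) * (poch_basis \<kappa> l m - single m 1))"
    (is "_ = (\<Sum>m\<in>_. ?p m)")
    using sum_single_lookup[of "keys c" c]
    by (simp add: poch_expand_def right_diff_distrib sum_subtractf const_def mult_single)
  moreover have "tot_degs (?p m) \<subseteq> {..<d}" if "m \<in> keys c" for m
  proof
    fix e assume "e \<in> tot_degs (?p m)"
    then obtain d1 d2 where e: "e = d1 + d2" "d1 \<in> degs (lookup c m)"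
        and d2: "d2 \<in> tot_degs (poch_basis \<kappa> l m - single m 1)"
      using tot_degs_mult[of "const (lookup c m)"] by (fastforce simp: const_def)
    have "d2 < mon_deg m"
      using d2 leading_form_poch_basis[of m l \<kappa>] that assms(1)
      by (auto simp: in_vars_def leading_form_def)
    moreover have "mon_deg m + d1 \<le> d"
      using degs_lookup[OF e(2)] assms(2) by auto
    ultimately show "e \<in> {..<d}"
      using e(1) by simp
  qed
  ultimately show ?thesis
    using tot_degs_sum[of ?p "keys c"] by fastforce
qed

lemma in_vars_poch_expand: "in_vars l (poch_expand \<kappa> l c)"
  unfolding poch_expand_def poch_basis_def by (intro in_vars_intros)

text \<open>If the difference \<open>b\<close> were nonzero with expansion 0, then
  \<open>poch_expand \<kappa> l b - b = - b\<close> would lie strictly below the top degree of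
  \<open>b\<close>.\<close>

lemma poch_expand_inj:
  assumes "in_vars l c" and "in_vars l c'" and "poch_expand \<kappa> l c = poch_expand \<kappa> l c'"
  shows "c = c'"
proof (rule ccontr)
  assume "c \<noteq> c'"
  define b where "b = c - c'"
  have "tot_degs b \<noteq> {}"
    using \<open>c \<noteq> c'\<close> by (simp add: tot_degs_empty_iff b_def)
  then have max: "Max (tot_degs b) \<in> tot_degs b" "tot_degs b \<subseteq> {..Max (tot_degs b)}"
    by (auto simp: finite_tot_degs)
  moreover have "in_vars l b"
    using assms by (simp add: b_def in_vars_diff)
  ultimately have "tot_degs (poch_expand \<kappa> l b - b) \<subseteq> {..<Max (tot_degs b)}"
    by (intro poch_expand_unitriangular)
  moreover have "poch_expand \<kappa> l b = 0"
    using assms by (simp add: b_def poch_expand_diff)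
  ultimately show False
    using max by auto
qed

text \<open>Successive approximation: \<open>p\<close> serves as its own first coefficient family,
  and the error, of lower degree, is expanded by induction on the degree bound.\<close>

lemma poch_expand_surj:
  assumes "in_vars l p" and "tot_degs p \<subseteq> {..<d}"
  shows "\<exists>c. in_vars l c \<and> tot_degs c \<subseteq> {..<d} \<and> poch_expand \<kappa> l c = p"
  using assms
proof (induction d arbitrary: p)
  case 0
  then have "p = 0"
    by (simp add: tot_degs_empty_iff)
  then show ?case
    by (intro exI[of _ 0]) (simp add: in_vars_def poch_expand_def)
next
  case (Suc d)
  define q where "q = p - poch_expand \<kappa> l p"
  have "tot_degs (poch_expand \<kappa> l p - p) \<subseteq> {..<d}"
    using Suc.prems by (intro poch_expand_unitriangular) (auto simp: lessThan_Suc_atMost)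
  moreover have "q = - (poch_expand \<kappa> l p - p)"
    by (simp add: q_def)
  ultimately have "tot_degs q \<subseteq> {..<d}"
    by (simp only: tot_degs_uminus)
  moreover have "in_vars l q"
    unfolding q_def using Suc.prems(1) by (intro in_vars_diff in_vars_poch_expand)
  ultimately obtain c where c: "in_vars l c" "tot_degs c \<subseteq> {..<d}" "poch_expand \<kappa> l c = q"
    using Suc.IH by blast
  have "tot_degs (p + c) \<subseteq> {..<Suc d}"
    using tot_degs_add[of p c] c(2) Suc.prems(2) by fastforce
  then show ?case
    using c Suc.prems(1)
    by (intro exI[of _ "p + c"]) (simp add: in_vars_add poch_expand_add q_def)
qed

text \<open>The coefficient family \<open>c\<close> and its expansion \<open>p\<close> differ only
  below degree \<open>d\<close>, so they share the leading form.\<close>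

lemma leading_form_poch_coeffs:
  assumes "in_vars l p" and "leading_form d p q"
  shows "\<exists>c. in_vars l c \<and> poch_expand \<kappa> l c = p \<and> leading_form d c q"
proof -
  have "tot_degs p \<subseteq> {..<Suc d}"
    using assms(2) tot_degs_add[of "p - q" q] by (fastforce simp: leading_form_def)
  then obtain c where c: "in_vars l c" "tot_degs c \<subseteq> {..<Suc d}" "poch_expand \<kappa> l c = p"
    using poch_expand_surj assms(1) by metis
  then have "tot_degs (p - c) \<subseteq> {..<d}"
    using poch_expand_unitriangular[of l c d \<kappa>] by (simp add: lessThan_Suc_atMost)
  moreover have "c - q = (p - q) - (p - c)"
    by simp
  ultimately have "leading_form d c q"
    using assms(2) tot_degs_diff[of "p - q" "p - c"] unfolding leading_form_def by fastforce
  then show ?thesis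
    using c by blast
qed

section \<open>Passage to the field of fractions\<close>

text \<open>Isolates the first factor, which has shift 0 and is the one that cancels a denominator
  \<open>x\<close>.\<close>

lemma poch_Suc: "poch \<kappa> x (Suc m) = x * poch \<kappa> (x - of_int \<kappa>) m"
proof -
  have "poch \<kappa> x (Suc m) = x * (\<Prod>i=1..m. x - of_int (int i * \<kappa>))"
    by (simp only: poch_def One_nat_def prod.atLeast1_atMost_eq prod.lessThan_Suc_shift) simp
  also have "(\<Prod>i=1..m. x - of_int (int i * \<kappa>)) = poch \<kappa> (x - of_int \<kappa>) m"
    unfolding poch_def by (intro prod.cong) (simp_all add: algebra_simps)
  finally show ?thesis .
qed

lemma to_fract_prod: "to_fract (\<Prod>i\<in>S. f i) = (\<Prod>i\<in>S. to_fract (f i))"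
  by (induction S rule: infinite_finite_induct) auto

lemma to_fract_power: "to_fract (x ^ m) = to_fract x ^ m"
  by (induction m) auto

lemma to_fract_of_nat: "to_fract (of_nat m) = of_nat m"
  by (induction m) auto

lemma to_fract_of_int: "to_fract (of_int c) = of_int c"
  by (cases c) (auto simp: to_fract_of_nat)

lemma to_fract_poch: "to_fract (poch \<kappa> x m) = poch \<kappa> (to_fract x) m"
  by (simp add: poch_def to_fract_prod to_fract_of_int del: of_int_mult of_int_diff)

section \<open>Cancellation of denominators\<close>

lemma finite_pairs: "finite (pairs l)"
  by (rule finite_subset[of _ "{1..l} \<times> {1..l}"]) (auto simp: pairs_def)

lemma card_pairs: "card (pairs l) = l * (l - 1) div 2"
proof -
  have "pairs l = (SIGMA i:{1..l}. {i<..l})"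
    by (auto simp: pairs_def)
  then have "card (pairs l) = (\<Sum>i=1..l. l - i)"
    by simp
  also have "\<dots> = (\<Sum>i<l. i)"
    by (rule sum.reindex_bij_witness[of _ "\<lambda>i. l - i" "\<lambda>i. l - i"]) auto
  also have "\<dots> = l * (l - 1) div 2"
    using Sum_Ico_nat[of 0 l] by (simp add: lessThan_atLeast0)
  finally show ?thesis .
qed

text \<open>Spreads a weight factor, with its special term at \<open>b\<close> and its terms below
  \<open>b\<close>, over all of \<open>1, ..., n\<close>, so that it merges with the master function
  factor by factor.\<close>

lemma prod_mult_initial_segment:
  fixes f :: "nat \<Rightarrow> 'a::comm_monoid_mult"
  assumes "b \<in> {1..n}"
  shows "(\<Prod>a=1..n. f a) * (c b * (\<Prod>j=1..b - 1. d j)) =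
    (\<Prod>a=1..n. f a * (if a = b then c a else if a < b then d a else 1))"
proof -
  have "(\<Prod>j=1..b - 1. d j) = (\<Prod>a\<in>{1..b - 1}. if a = b then c a else if a < b then d a else 1)"
    using assms by (intro prod.cong) auto
  also have "\<dots> = (\<Prod>a\<in>{1..n} - {b}. if a = b then c a else if a < b then d a else 1)"
    using assms by (intro prod.mono_neutral_left) auto
  finally show ?thesis
    by (simp add: prod.distrib prod.remove[OF _ assms] del: atLeastAtMost_iff One_nat_def)
qed

text \<open>Here \<open>b\<close> plays the role of \<open>a_i\<close>. The value is
  \<open>poch \<kappa> x k\<close>, with its first factor \<open>x\<close> removed, times what the
  weight function leaves in the place of \<open>x\<close>.\<close>

definition z_factor_qKZ :: "int \<Rightarrow> nat \<Rightarrow> nat \<Rightarrow> nat \<Rightarrow> 'a::comm_ring_1 \<Rightarrow> 'a" where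
  "z_factor_qKZ \<kappa> k b a x =
     (if a = b then 1 else if a < b then x - of_int (\<kappa> * int k) else x) *
     poch \<kappa> (x - of_int \<kappa>) (k - 1)"

definition t_factor_qKZ :: "int \<Rightarrow> nat \<Rightarrow> bool \<Rightarrow> 'a::comm_ring_1 \<Rightarrow> 'a" where
  "t_factor_qKZ \<kappa> k' inverted y =
     (if inverted then y - of_int (\<kappa> * int k') else y) * poch \<kappa> (y - of_int \<kappa>) (k' - 1)"

definition z_factor_KZ :: "nat \<Rightarrow> nat \<Rightarrow> nat \<Rightarrow> 'a::comm_ring_1 \<Rightarrow> 'a" where
  "z_factor_KZ k b a x = (if a = b then 1 else x) * x ^ (k - 1)"

text \<open>The products of master and weight functions after cancelling all denominators: every
  denominator is the first factor of one of the Pochhammer polynomials.\<close>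

definition qKZ_poly ::
  "int \<Rightarrow> nat \<Rightarrow> nat \<Rightarrow> nat \<Rightarrow> nat \<Rightarrow> nat set \<Rightarrow> (nat \<Rightarrow> 'a::comm_ring_1) \<Rightarrow> (nat \<Rightarrow> 'a) \<Rightarrow> 'a" where
  "qKZ_poly \<kappa> k k' n l I t z =
     (\<Sum>\<tau> | \<tau> permutes {1..l}.
        (\<Prod>i=1..l. \<Prod>a=1..n. z_factor_qKZ \<kappa> k (elt I i) a (t (\<tau> i) - z a)) *
        (\<Prod>(i, j)\<in>pairs l. t_factor_qKZ \<kappa> k' (\<tau> i > \<tau> j) (t i - t j + 1)))"

definition KZ_poly ::
  "nat \<Rightarrow> nat \<Rightarrow> nat \<Rightarrow> nat \<Rightarrow> nat set \<Rightarrow> (nat \<Rightarrow> 'a::comm_ring_1) \<Rightarrow> (nat \<Rightarrow> 'a) \<Rightarrow> 'a" where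
  "KZ_poly k k' n l I t z =
     (\<Sum>\<tau> | \<tau> permutes {1..l}.
        (\<Prod>i=1..l. \<Prod>a=1..n. z_factor_KZ k (elt I i) a (t (\<tau> i) - z a)) *
        (\<Prod>(i, j)\<in>pairs l. (t i - t j) ^ k'))"

text \<open>No division remains, so the formula makes sense in any commutative ring and commutes
  with the embedding into the fraction field.\<close>

lemma to_fract_qKZ_poly:
  "to_fract (qKZ_poly \<kappa> k k' n l I t z) =
     qKZ_poly \<kappa> k k' n l I (\<lambda>i. to_fract (t i)) (\<lambda>a. to_fract (z a))"
  by (simp add: qKZ_poly_def z_factor_qKZ_def t_factor_qKZ_def to_fract_prod to_fract_poch
      to_fract_of_int case_prod_unfold if_distrib[of to_fract] del: of_int_mult cong: if_cong)

lemma to_fract_KZ_poly: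
  "to_fract (KZ_poly k k' n l I t z) =
     KZ_poly k k' n l I (\<lambda>i. to_fract (t i)) (\<lambda>a. to_fract (z a))"
  by (simp add: KZ_poly_def z_factor_KZ_def to_fract_prod to_fract_power case_prod_unfold
      if_distrib[of to_fract] cong: if_cong)

text \<open>The \<open>z\<close>-part of the master function is symmetric in \<open>t\<close>;
  re-indexing by \<tau> aligns it with the denominators in \<open>t (\<tau> i)\<close>.\<close>

lemma prod_permuted:
  assumes "\<tau> permutes {1..l}"
  shows "(\<Prod>a=1..n. \<Prod>i=1..l. F (t i) a) = (\<Prod>i=1..l. \<Prod>a=1..n. F (t (\<tau> i)) (a::nat))"
  by (subst prod.swap, subst prod.permute[OF assms]) (simp add: o_def)

lemma Phi_qKZ_mult_w_qKZ:
  fixes t z :: "nat \<Rightarrow> 'a::field"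
  assumes "k > 0" and "k' > 0" and elt: "\<And>i. i \<in> {1..l} \<Longrightarrow> elt I i \<in> {1..n}"
    and nz: "\<And>i a. i \<in> {1..l} \<Longrightarrow> t i \<noteq> z a"
    and nz': "\<And>i j. (i, j) \<in> pairs l \<Longrightarrow> t i - t j + 1 \<noteq> 0"
  shows "Phi_qKZ \<kappa> k k' n l t z * w_qKZ \<kappa> k k' l I t z = qKZ_poly \<kappa> k k' n l I t z"
  unfolding w_qKZ_def qKZ_poly_def sum_distrib_left
proof (intro sum.cong refl)
  fix \<tau> assume "\<tau> \<in> {\<tau>. \<tau> permutes {1..l}}"
  then have \<tau>: "\<tau> permutes {1..l}"
    by simp
  obtain h h' where h: "k = Suc h" "k' = Suc h'"
    using assms(1,2) gr0_implies_Suc by blast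
  \<comment> \<open>\<open>A\<close> and \<open>C\<close> come from the master function,
    \<open>B\<close> and \<open>D\<close> from the summand of the weight at \<tau>. The denominators
    of \<open>B\<close> cancel against \<open>A\<close>, those of \<open>D\<close> against
    \<open>C\<close>.\<close>
  define A where "A = (\<Prod>i=1..l. \<Prod>a=1..n. poch \<kappa> (t (\<tau> i) - z a) k)"
  define B where "B = (\<Prod>i=1..l. 1 / (t (\<tau> i) - z (elt I i)) *
    (\<Prod>j=1..elt I i - 1. (t (\<tau> i) - z j - of_int (\<kappa> * int k)) / (t (\<tau> i) - z j)))"
  define C where "C = (\<Prod>(i, j)\<in>pairs l. poch \<kappa> (t i - t j + 1) k')"
  define D where "D = (\<Prod>(i, j)\<in>{(i, j)\<in>pairs l. \<tau> i > \<tau> j}.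
    (t i - t j + 1 - of_int (\<kappa> * int k')) / (t i - t j + 1))"
  have AB: "A * B = (\<Prod>i=1..l. \<Prod>a=1..n. z_factor_qKZ \<kappa> k (elt I i) a (t (\<tau> i) - z a))"
    unfolding A_def B_def prod.distrib[symmetric]
  proof (intro prod.cong[OF refl])
    fix i assume i: "i \<in> {1..l}"
    then have "t (\<tau> i) - z a \<noteq> 0" for a
      using nz \<tau> by (simp add: permutes_in_image del: atLeastAtMost_iff)
    then show "(\<Prod>a=1..n. poch \<kappa> (t (\<tau> i) - z a) k) * (1 / (t (\<tau> i) - z (elt I i)) *
        (\<Prod>j=1..elt I i - 1. (t (\<tau> i) - z j - of_int (\<kappa> * int k)) / (t (\<tau> i) - z j))) =
      (\<Prod>a=1..n. z_factor_qKZ \<kappa> k (elt I i) a (t (\<tau> i) - z a))"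
      by (subst prod_mult_initial_segment[OF elt[OF i], where c = "\<lambda>a. 1 / (t (\<tau> i) - z a)"])
        (auto intro!: prod.cong simp: z_factor_qKZ_def h poch_Suc simp del: of_int_mult)
  qed
  \<comment> \<open>The product over inversions is padded with ones to all pairs, to match
    \<open>C\<close>.\<close>
  have "D = (\<Prod>p\<in>pairs l. if \<tau> (fst p) > \<tau> (snd p) then
      (t (fst p) - t (snd p) + 1 - of_int (\<kappa> * int k')) / (t (fst p) - t (snd p) + 1) else 1)"
    unfolding D_def prod.inter_filter[OF finite_pairs, symmetric]
    by (intro prod.cong) auto
  then have CD: "C * D = (\<Prod>(i, j)\<in>pairs l. t_factor_qKZ \<kappa> k' (\<tau> i > \<tau> j) (t i - t j + 1))"
    unfolding C_def using nz'
    by (auto simp: prod.distrib[symmetric] t_factor_qKZ_def h poch_Suc simp del: of_int_mult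
        intro!: prod.cong)
  have "Phi_qKZ \<kappa> k k' n l t z = A * C"
    unfolding Phi_qKZ_def A_def C_def prod_permuted[OF \<tau>, of "\<lambda>x a. poch \<kappa> (x - z a) k"] ..
  then have "Phi_qKZ \<kappa> k k' n l t z * act \<kappa> k' l \<tau>
      (\<lambda>s. \<Prod>i=1..l. 1 / (s i - z (elt I i)) *
         (\<Prod>j=1..elt I i - 1. (s i - z j - of_int (\<kappa> * int k)) / (s i - z j))) t =
      (A * B) * (C * D)"
    unfolding act_def B_def D_def by (simp add: mult_ac)
  then show "Phi_qKZ \<kappa> k k' n l t z * act \<kappa> k' l \<tau>
      (\<lambda>s. \<Prod>i=1..l. 1 / (s i - z (elt I i)) *
         (\<Prod>j=1..elt I i - 1. (s i - z j - of_int (\<kappa> * int k)) / (s i - z j))) t =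
      (\<Prod>i=1..l. \<Prod>a=1..n. z_factor_qKZ \<kappa> k (elt I i) a (t (\<tau> i) - z a)) *
      (\<Prod>(i, j)\<in>pairs l. t_factor_qKZ \<kappa> k' (\<tau> i > \<tau> j) (t i - t j + 1))"
    unfolding AB CD .
qed

lemma Phi_KZ_mult_w_KZ:
  fixes t z :: "nat \<Rightarrow> 'a::field"
  assumes "k > 0" and elt: "\<And>i. i \<in> {1..l} \<Longrightarrow> elt I i \<in> {1..n}"
    and nz: "\<And>i a. i \<in> {1..l} \<Longrightarrow> t i \<noteq> z a"
  shows "Phi_KZ k k' n l t z * w_KZ l I t z = KZ_poly k k' n l I t z"
  unfolding w_KZ_def KZ_poly_def sum_distrib_left
proof (intro sum.cong refl)
  fix \<tau> assume "\<tau> \<in> {\<tau>. \<tau> permutes {1..l}}"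
  then have \<tau>: "\<tau> permutes {1..l}"
    by simp
  obtain h where h: "k = Suc h"
    using assms(1) gr0_implies_Suc by blast
  have "(\<Prod>i=1..l. \<Prod>a=1..n. (t (\<tau> i) - z a) ^ k) * (\<Prod>i=1..l. 1 / (t (\<tau> i) - z (elt I i))) =
      (\<Prod>i=1..l. \<Prod>a=1..n. z_factor_KZ k (elt I i) a (t (\<tau> i) - z a))"
    unfolding prod.distrib[symmetric]
  proof (intro prod.cong[OF refl])
    fix i assume i: "i \<in> {1..l}"
    then have "t (\<tau> i) - z a \<noteq> 0" for a
      using nz \<tau> by (simp add: permutes_in_image del: atLeastAtMost_iff)
    then show "(\<Prod>a=1..n. (t (\<tau> i) - z a) ^ k) * (1 / (t (\<tau> i) - z (elt I i))) =
      (\<Prod>a=1..n. z_factor_KZ k (elt I i) a (t (\<tau> i) - z a))"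
      \<comment> \<open>The KZ weight has no factors below \<open>elt I i\<close>, hence the
        constant \<open>d = 1\<close>.\<close>
      using prod_mult_initial_segment[OF elt[OF i], where c = "\<lambda>a. 1 / (t (\<tau> i) - z a)"
          and d = "\<lambda>_. 1" and f = "\<lambda>a. (t (\<tau> i) - z a) ^ k"]
      by (auto intro!: prod.cong simp: z_factor_KZ_def h)
  qed
  moreover have "Phi_KZ k k' n l t z = (\<Prod>i=1..l. \<Prod>a=1..n. (t (\<tau> i) - z a) ^ k) *
      (\<Prod>(i, j)\<in>pairs l. (t i - t j) ^ k')"
    unfolding Phi_KZ_def prod_permuted[OF \<tau>, of "\<lambda>x a. (x - z a) ^ k"] ..
  ultimately show "Phi_KZ k k' n l t z * (\<Prod>i=1..l. 1 / (t (\<tau> i) - z (elt I i))) =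
      (\<Prod>i=1..l. \<Prod>a=1..n. z_factor_KZ k (elt I i) a (t (\<tau> i) - z a)) *
      (\<Prod>(i, j)\<in>pairs l. (t i - t j) ^ k')"
    by (simp add: mult_ac)
qed

section \<open>Nonvanishing denominators at the generic point and explicit formulas for the
  \<open>U_I\<close>\<close>

lemma elt_in_range:
  assumes "I \<in> subsets n l" and "i \<in> {1..l}"
  shows "elt I i \<in> {1..n}"
proof -
  have I: "finite I" "I \<subseteq> {1..n}" "card I = l"
    using assms(1) finite_subset[of I "{1..n}"] by (auto simp: subsets_def)
  then have "sorted_list_of_set I ! (i - 1) \<in> set (sorted_list_of_set I)"
    using assms(2) by (intro nth_mem) auto
  then show ?thesis
    using I by (auto simp: elt_def)
qed

lemma lookup_tvar: "lookup (tvar i) (single j 1) = (if i = j then 1 else 0)"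
proof -
  have "single i (1::nat) = single j 1 \<Longrightarrow> i = j"
    by (metis keys_single singleton_inject zero_neq_one)
  then show ?thesis
    by (auto simp: tvar_def var_def lookup_single when_def)
qed

lemma tvar_neq_zvar: "tvar i \<noteq> zvar a"
proof
  have *: "single i 1 \<noteq> (0::mon)"
    by (metis keys_single keys_zero insert_not_empty zero_neq_one)
  assume "tvar i = zvar a"
  then have "lookup (tvar i) (single i 1) = lookup (zvar a) (single i 1)"
    by simp
  then show False
    using * by (simp add: lookup_tvar zvar_def const_def lookup_single when_def del: One_nat_def)
qed

text \<open>The coefficient of \<open>tvar i\<close> is 1.\<close>

lemma tvar_diff_neq: "i \<noteq> j \<Longrightarrow> tvar i - tvar j + 1 \<noteq> 0"
proof
  have *: "single i 1 \<noteq> (0::mon)"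
    by (metis keys_single keys_zero insert_not_empty zero_neq_one)
  assume "i \<noteq> j" "tvar i - tvar j + 1 = 0"
  then have "lookup (tvar i - tvar j + 1) (single i 1) = 0"
    by simp
  then show False
    using * \<open>i \<noteq> j\<close>
      by (simp add: lookup_tvar lookup_add lookup_minus lookup_one when_def del: One_nat_def)
qed

text \<open>With the denominators cancelled, the defining fraction is the image of a polynomial;
  injectivity of \<open>to_fract\<close> then resolves the description.\<close>

lemma U_qKZ_eq:
  assumes "k > 0" and "k' > 0" and "I \<in> subsets n l"
  shows "U_qKZ \<kappa> k k' n l I = qKZ_poly \<kappa> k k' n l I tvar zvar"
proof -
  have *: "to_fract (tvar i) - to_fract (tvar j) + 1 \<noteq> 0" if "(i, j) \<in> pairs l" for i j
  proof -
    have "to_fract (tvar i - tvar j + 1) \<noteq> 0"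
      unfolding to_fract_eq_0_iff using that by (intro tvar_diff_neq) (auto simp: pairs_def)
    then show ?thesis
      by simp
  qed
  show ?thesis
    unfolding U_qKZ_def using assms
    by (subst Phi_qKZ_mult_w_qKZ)
      (auto simp: * tvar_neq_zvar elt_in_range simp flip: to_fract_qKZ_poly
        simp del: atLeastAtMost_iff One_nat_def)
qed

lemma U_KZ_eq:
  assumes "k > 0" and "I \<in> subsets n l"
  shows "U_KZ k k' n l I = KZ_poly k k' n l I tvar zvar"
  unfolding U_KZ_def using assms
  by (subst Phi_KZ_mult_w_KZ)
    (auto simp: tvar_neq_zvar elt_in_range simp flip: to_fract_KZ_poly
      simp del: atLeastAtMost_iff One_nat_def)

lemma in_vars_qKZ_poly: "in_vars l (qKZ_poly \<kappa> k k' n l I tvar zvar)"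
proof -
  have "in_vars l (z_factor_qKZ \<kappa> k (elt I i) a (tvar (\<tau> i) - zvar a))"
    if "\<tau> permutes {1..l}" and "i \<in> {1..l}" for \<tau> i a
  proof -
    have "\<tau> i \<in> {1..l}"
      using that by (simp add: permutes_in_image del: atLeastAtMost_iff)
    then show ?thesis
      unfolding z_factor_qKZ_def
      by (auto simp del: of_int_mult atLeastAtMost_iff intro!: in_vars_intros)
  qed
  moreover have "in_vars l (t_factor_qKZ \<kappa> k' b (tvar i - tvar j + 1))"
    if "(i, j) \<in> pairs l" for i j b
    using that unfolding t_factor_qKZ_def
    by (auto simp: pairs_def simp del: of_int_mult intro!: in_vars_intros)
  ultimately show ?thesis
    unfolding qKZ_poly_def case_prod_unfold
    by (intro in_vars_sum in_vars_mult in_vars_prod) auto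
qed

section \<open>Leading forms of the weighted master functions\<close>

text \<open>The shift in the case \<open>a < b\<close> disappears, so the three cases of qKZ
  collapse to the two of KZ. One degree is lost at \<open>a = b\<close>.\<close>

lemma leading_form_z_factor:
  assumes "leading_form 1 x y"
  shows "leading_form ((if a = b then 0 else 1) + (k - 1))
    (z_factor_qKZ \<kappa> k b a x) (z_factor_KZ k b a y)"
  unfolding z_factor_qKZ_def z_factor_KZ_def
  by (intro leading_form_mult leading_form_poch leading_form_1_diff_of_int assms)
    (auto simp del: of_int_mult One_nat_def
      intro!: leading_form_1_diff_of_int leading_form_one assms)

text \<open>Both branches have the same leading form: inversions of \<tau> do not show in top
  degree, and the action becomes plain permutation of variables.\<close>

lemma leading_form_t_factor:
  assumes "k' > 0" and "leading_form 1 x y"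
  shows "leading_form k' (t_factor_qKZ \<kappa> k' b x) (y ^ k')"
proof -
  have "leading_form (1 + (k' - 1)) (t_factor_qKZ \<kappa> k' b x) (y * y ^ (k' - 1))"
    unfolding t_factor_qKZ_def
    by (intro leading_form_mult leading_form_poch leading_form_1_diff_of_int assms)
      (auto simp del: of_int_mult One_nat_def intro!: leading_form_1_diff_of_int assms)
  then show ?thesis
    using assms(1) by (simp add: power_eq_if)
qed

lemma leading_form_tvar_diff_zvar: "leading_form 1 (tvar i - zvar a) (tvar i - zvar a)"
  using tot_degs_diff[of "tvar i" "zvar a"]
  by (auto simp: leading_form_def tot_degs_tvar tot_degs_zvar)

lemma leading_form_tvar_diff_tvar: "leading_form 1 (tvar i - tvar j + 1) (tvar i - tvar j)"
  using tot_degs_diff[of "tvar i" "tvar j"] by (auto simp: leading_form_def tot_degs_tvar)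

text \<open>Each \<open>i\<close> contributes \<open>n * k - 1\<close>, one degree being lost at
  \<open>elt I i\<close>, and each pair contributes \<open>k'\<close>. This count does not depend on
  \<tau>, so the leading forms can be summed.\<close>

lemma leading_form_qKZ_poly:
  assumes "k > 0" and "k' > 0" and "I \<in> subsets n l"
  shows "leading_form (l * (n * k - 1) + card (pairs l) * k')
    (qKZ_poly \<kappa> k k' n l I tvar zvar) (KZ_poly k k' n l I tvar zvar)"
proof -
  have deg: "(\<Sum>a=1..n. (if a = elt I i then 0 else 1) + (k - 1)) = n * k - 1"
    if "i \<in> {1..l}" for i
  proof -
    \<comment> \<open>Adding back the one missing degree makes every summand equal to
      \<open>k\<close> and avoids truncated subtraction.\<close>
    have "(\<Sum>a=1..n. (if a = elt I i then 0 else 1) + (k - 1)) +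
        (\<Sum>a=1..n. if a = elt I i then 1 else 0) = (\<Sum>a=1..n. k)"
      unfolding sum.distrib[symmetric] using assms(1) by (intro sum.cong) auto
    moreover have "(\<Sum>a=1..n. if a = elt I i then 1 else 0) = (1::nat)"
      using elt_in_range[OF assms(3) that] by simp
    ultimately show ?thesis
      by simp
  qed
  have "leading_form (n * k - 1)
      (\<Prod>a=1..n. z_factor_qKZ \<kappa> k (elt I i) a (tvar (\<tau> i) - zvar a))
      (\<Prod>a=1..n. z_factor_KZ k (elt I i) a (tvar (\<tau> i) - zvar a))"
    if "i \<in> {1..l}" for i and \<tau> :: "nat \<Rightarrow> nat"
    unfolding deg[OF that, symmetric]
    by (intro leading_form_prod leading_form_z_factor leading_form_tvar_diff_zvar)
  then have "leading_form (\<Sum>i=1..l. n * k - 1)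
      (\<Prod>i=1..l. \<Prod>a=1..n. z_factor_qKZ \<kappa> k (elt I i) a (tvar (\<tau> i) - zvar a))
      (\<Prod>i=1..l. \<Prod>a=1..n. z_factor_KZ k (elt I i) a (tvar (\<tau> i) - zvar a))" for \<tau> :: "nat \<Rightarrow> nat"
    by (intro leading_form_prod)
  moreover have "leading_form (\<Sum>p\<in>pairs l. k')
      (\<Prod>(i, j)\<in>pairs l. t_factor_qKZ \<kappa> k' (\<tau> i > \<tau> j) (tvar i - tvar j + 1))
      (\<Prod>(i, j)\<in>pairs l. (tvar i - tvar j) ^ k')" for \<tau> :: "nat \<Rightarrow> nat"
    unfolding case_prod_unfold
    by (intro leading_form_prod leading_form_t_factor leading_form_tvar_diff_tvar assms)
  ultimately show ?thesis
    unfolding qKZ_poly_def KZ_poly_def by (intro leading_form_sum leading_form_mult) simp_all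
qed

text \<open>The coefficient family is the unique preimage of \<open>U_I\<close> under
  \<open>poch_expand\<close>, so it inherits the leading form of \<open>U_I\<close>.\<close>

lemma leading_form_coeff_qKZ:
  assumes "k > 0" and "k' > 0" and "I \<in> subsets n l"
  shows "leading_form (l * (n * k - 1) + card (pairs l) * k')
    (coeff_qKZ \<kappa> k k' n l I) (U_KZ k k' n l I)"
proof -
  obtain c where c: "in_vars l c" "poch_expand \<kappa> l c = U_qKZ \<kappa> k k' n l I"
      "leading_form (l * (n * k - 1) + card (pairs l) * k') c (U_KZ k k' n l I)"
    using leading_form_poch_coeffs[OF in_vars_qKZ_poly leading_form_qKZ_poly[OF assms], of \<kappa>]
    unfolding U_qKZ_eq[OF assms] U_KZ_eq[OF assms(1,3)] by blast
  have "coeff_qKZ \<kappa> k k' n l I = c"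
    unfolding coeff_qKZ_def poch_basis_def[symmetric] poch_expand_def[symmetric] in_vars_def[symmetric]
    using c(1,2) by (intro the_equality) (auto intro!: poch_expand_inj[of l _ c \<kappa>])
  then show ?thesis
    using c(3) by simp
qed

section \<open>Tensor coefficients, normalization and the degree formula\<close>

lemma lookup_smult_tensor: "lookup (smult_tensor c v) x = c * lookup v x"
  by (simp add: smult_tensor_def Poly_Mapping.map.rep_eq when_def)

lemma lookup_smult_tensor_basis:
  "lookup (smult_tensor c (v_basis n I)) x =
     (if x = map (\<lambda>j. if j \<in> I then 2 else 1) [1..<n + 1] then c else 0)"
  by (simp add: lookup_smult_tensor v_basis_def lookup_single when_def)

lemma keys_lookup_tensor_sum:
  assumes "m \<in> keys (lookup (\<Sum>I\<in>S. smult_tensor (c I) (v_basis n I)) x)"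
  shows "\<exists>I\<in>S. m \<in> keys (c I)"
proof (rule ccontr)
  assume *: "\<not> ?thesis"
  have "lookup (lookup (\<Sum>I\<in>S. smult_tensor (c I) (v_basis n I)) x) m =
      (\<Sum>I\<in>S. lookup (lookup (smult_tensor (c I) (v_basis n I)) x) m)"
    by (simp add: lookup_sum)
  also have "\<dots> = 0"
    using * by (intro sum.neutral) (auto simp: lookup_smult_tensor_basis in_keys_iff)
  finally show False
    using assms by (simp add: in_keys_iff)
qed

lemma smult_tensor_diff: "smult_tensor c v - smult_tensor c' v = smult_tensor (c - c') v"
  by (rule poly_mapping_eqI) (simp add: lookup_smult_tensor lookup_minus left_diff_distrib)

lemma norm_factor_eq_1:
  assumes "\<And>i. i \<in> {1..l} \<Longrightarrow> [int (lookup r i) = - 1] (mod N)"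
  shows "norm_factor N l r = 1"
  unfolding norm_factor_def
proof (rule Least_equality)
  have "[int (lookup r i) + 1 = - 1 + 1] (mod N)" if "i \<in> {1..l}" for i
    using assms[OF that] by (intro cong_add) auto
  then show "0 < (1::nat) \<and> (\<forall>i\<in>{1..l}. [int 1 * (int (lookup r i) + 1) = 0] (mod N))"
    by simp
qed auto

text \<open>Since \<open>n * k\<close> is positive, \<open>n * k - 1\<close> is a true difference of
  natural numbers; the subtraction of \<open>mon_deg r\<close> is done in the integers, as it may go
  below zero.\<close>

lemma deg_KZ_eq:
  assumes "k > 0" and "n > 0" and "keys r \<subseteq> {1..l}"
  shows "deg_KZ k k' n l r = int (l * (n * k - 1) + card (pairs l) * k') - int (mon_deg r)"
proof -
  have "int (l * (n * k - 1)) = int n * int l * int k - int l"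
    using assms(1,2) by (simp add: of_nat_diff Suc_leI algebra_simps)
  moreover have "int (card (pairs l)) = int l * (int l - 1) div 2"
    unfolding card_pairs by (cases l) (simp_all add: zdiv_int algebra_simps)
  ultimately show ?thesis
    using assms(3) by (simp add: deg_KZ_def mon_deg_superset[of "{1..l}"])
qed

theorem proposition6p2:
  fixes \<kappa> N :: int and k k' n l :: nat and r :: mon
  assumes "coprime \<kappa> N" and "0 < \<kappa>" and "\<kappa> < N"
    and "0 < k" and "int k < N" and "[\<kappa> * int k = - 1] (mod N)"
    and "0 < k'" and "int k' < N" and "[\<kappa> * int k' = 2] (mod N)"
    and "n > 1" and "l \<ge> 1" and "2 * l \<le> n"
    and "Poly_Mapping.keys r \<subseteq> {1..l}"
    and "\<And>i. i \<in> {1..l} \<Longrightarrow> Poly_Mapping.lookup r i > 0"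
    and "\<And>i. i \<in> {1..l} \<Longrightarrow> [int (Poly_Mapping.lookup r i) = - 1] (mod N)"
  shows "homogeneous_of_degree (deg_KZ k k' n l r) (f_KZ k k' n l r) \<and>
    (\<exists>g. f_qKZ N \<kappa> k k' n l r = f_KZ k k' n l r + g \<and>
         terms_of_degree_less (deg_KZ k k' n l r) g)"
proof -
  \<comment> \<open>The total degree in \<open>t\<close> and \<open>z\<close> together; passing to
    the coefficient at \<open>r\<close> subtracts \<open>mon_deg r\<close>.\<close>
  define d where "d = l * (n * k - 1) + card (pairs l) * k'"
  have d: "deg_KZ k k' n l r = int d - int (mon_deg r)"
    unfolding d_def using assms(4,10,13) by (intro deg_KZ_eq) auto
  let ?c = "\<lambda>I. lookup (coeff_qKZ \<kappa> k k' n l I) r"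
  let ?u = "\<lambda>I. lookup (U_KZ k k' n l I) r"
  define g where "g = (\<Sum>I\<in>subsets n l. smult_tensor (?c I - ?u I) (v_basis n I))"
  have lf: "leading_form d (coeff_qKZ \<kappa> k k' n l I) (U_KZ k k' n l I)" if "I \<in> subsets n l" for I
    unfolding d_def using leading_form_coeff_qKZ assms(4,7) that by blast
  have "norm_factor N l r = 1"
    using assms(15) by (rule norm_factor_eq_1)
  moreover have "smult_tensor 1 f = f" for f
    by (rule poly_mapping_eqI) (simp add: lookup_smult_tensor)
  ultimately have "f_qKZ N \<kappa> k k' n l r = (\<Sum>I\<in>subsets n l. smult_tensor (?c I) (v_basis n I))"
    unfolding f_qKZ_def by simp
  then have "f_qKZ N \<kappa> k k' n l r = f_KZ k k' n l r + g"
    unfolding f_KZ_def g_def smult_tensor_diff[symmetric] sum_subtractf by simp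
  moreover have "terms_of_degree_less (deg_KZ k k' n l r) g"
    unfolding terms_of_degree_less_def
  proof (intro allI ballI)
    fix x m assume m: "m \<in> keys (lookup g x)"
    obtain I where I: "I \<in> subsets n l" "m \<in> keys (?c I - ?u I)"
      using keys_lookup_tensor_sum[OF m[unfolded g_def]] by blast
    \<comment> \<open>A monomial \<open>m\<close> in \<open>z\<close> inside the coefficient at
      \<open>r\<close> counts with the total degree of both, which the leading form bounds by
      \<open>d\<close>.\<close>
    then have "mon_deg r + mon_deg m \<in> tot_degs (coeff_qKZ \<kappa> k k' n l I - U_KZ k k' n l I)"
      by (intro degs_lookup) (auto simp: degs_def lookup_minus)
    then show "int (mon_deg m) < deg_KZ k k' n l r"
      using lf[OF I(1)] by (auto simp: d leading_form_def)
  qed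
  moreover have "homogeneous_of_degree (deg_KZ k k' n l r) (f_KZ k k' n l r)"
    unfolding homogeneous_of_degree_def
  proof (intro allI ballI)
    fix x m assume m: "m \<in> keys (lookup (f_KZ k k' n l r) x)"
    obtain I where I: "I \<in> subsets n l" "m \<in> keys (?u I)"
      using keys_lookup_tensor_sum[OF m[unfolded f_KZ_def]] by blast
    then have "mon_deg r + mon_deg m \<in> tot_degs (U_KZ k k' n l I)"
      by (intro degs_lookup) (auto simp: degs_def)
    then show "int (mon_deg m) = deg_KZ k k' n l r"
      using lf[OF I(1)] by (auto simp: d leading_form_def)
  qed
  ultimately show ?thesis
    by blast
qed

end
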